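(* Fix an integer $d \geq 2$, an integer $k \geq 1$ and an integer $M \geq 2$. Consider a tensor network consisting of $n$ tensors, each having at most $M$ entries, which is to be fully contracted to a scalar. Suppose the tensors can be represented by closed balls ("spheres") in $\mathbb{R}^d$, one per tensor, with centers and radii chosen such that (i) whenever two tensors share a contracted index, their balls intersect, and (ii) every point of $\mathbb{R}^d$ is contained in at most $k$ of the balls, where $k$ does not depend on $n$. Then, for all sufficiently large $n$, the tensor network can be contracted to a scalar by a sequence of pairwise tensor contractions using at most $$2\, n^{1/\log_2\left(\frac{d+2}{d+1}\right)}\; M^{\,a_d\, k^{1/d}\, n^{1-1/d}}$$ scalar operations (multiplications and additions), where $a_d = \dfrac{c_d}{2-2\left(\frac{d+1}{d+2}\right)^{1-1/d}}$.
   Context: A tensor network is a collection of tensors (multi-dimensional arrays of complex numbers), each index of which has a finite dimension; an index shared by two tensors is contracted, i.e. summed over. Full contraction to a scalar means all indices are summed over. Contracting two tensors pairwise costs a number of scalar multiplications equal to the product of the dimensions of all indices of the two tensors (shared indices counted once), plus at most as many additions. The constant $c_d$ is the constant of the Sphere Separator Theorem (Miller–Teng–Thurston–Vavasis): for every set of $n$ balls in $\mathbb{R}^d$ such that each point lies in at most $k$ balls, there exists a sphere $S$ such that the set $\Gamma_O(S)$ of balls intersecting $S$ satisfies $|\Gamma_O(S)| \leq c_d k^{1/d} n^{1-1/d}$, and the balls strictly inside and strictly outside $S$ form two mutually non-intersecting sets each of size at most $\frac{d+1}{d+2} n$. Known values: $c_2 = 2$, $c_3 < 2.135$, $c_4 <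 2.280$, $c_5 < 2.421$, and in general $c_d < \sqrt{2d/\pi}\,[1+O(1/\log d)]$. *)

theory Defs
  imports "HOL-Analysis.Analysis"
begin

text \<open>A tensor network on tensors 0..<n is given by a finite set E of (contracted)
  index names, a map inc giving for each tensor the set of its indices, and
  a map dm giving each index its (positive) dimension. Full contraction to a
  scalar: every index is shared by exactly two distinct tensors.\<close>

definition tensor_network ::
  "nat \<Rightarrow> nat set \<Rightarrow> (nat \<Rightarrow> nat set) \<Rightarrow> (nat \<Rightarrow> nat) \<Rightarrow> bool" where
  "tensor_network n E inc dm \<longleftrightarrow>
     finite E \<and> (\<forall>e\<in>E. dm e \<ge> 1) \<and> (\<forall>i<n. inc i \<subseteq> E) \<and>
     (\<forall>e\<in>E. card {i. i < n \<and> e \<in> inc i} = 2)"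

definition tensor_size :: "(nat \<Rightarrow> nat set) \<Rightarrow> (nat \<Rightarrow> nat) \<Rightarrow> nat \<Rightarrow> nat" where
  "tensor_size inc dm i = (\<Prod>e\<in>inc i. dm e)"

text \<open>Open (uncontracted) indices of the tensor obtained by contracting the set S
  of original tensors: those indices with exactly one of their tensors in S.\<close>
definition open_idx :: "nat set \<Rightarrow> (nat \<Rightarrow> nat set) \<Rightarrow> nat set \<Rightarrow> nat set" where
  "open_idx E inc S = {e \<in> E. card {i \<in> S. e \<in> inc i} = 1}"

text \<open>Scalar operations of a pairwise contraction of the tensors for S and T:
  multiplications = product of the dimensions of all indices of both tensors
  (shared indices counted once); additions = (number of output entries) times
  (number of summands per entry minus one).\<close>
definition pair_ops ::
  "nat set \<Rightarrow> (nat \<Rightarrow> nat set) \<Rightarrow> (nat \<Rightarrow> nat) \<Rightarrow> nat set \<Rightarrow> nat set \<Rightarrow> nat" where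
  "pair_ops E inc dm S T =
     (let A = open_idx E inc S; B = open_idx E inc T in
        (\<Prod>e\<in>A \<union> B. dm e)
        + (\<Prod>e\<in>(A \<union> B) - (A \<inter> B). dm e) * ((\<Prod>e\<in>A \<inter> B. dm e) - 1))"

text \<open>A contraction order (sequence of pairwise contractions) as a binary tree.\<close>
datatype ctree = Leaf nat | Node ctree ctree

fun leaves :: "ctree \<Rightarrow> nat list" where
  "leaves (Leaf i) = [i]"
| "leaves (Node l r) = leaves l @ leaves r"

definition valid_ctree :: "nat \<Rightarrow> ctree \<Rightarrow> bool" where
  "valid_ctree n t \<longleftrightarrow> distinct (leaves t) \<and> set (leaves t) = {..<n}"

fun ccost :: "nat set \<Rightarrow> (nat \<Rightarrow> nat set) \<Rightarrow> (nat \<Rightarrow> nat) \<Rightarrow> ctree \<Rightarrow> nat" where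
  "ccost E inc dm (Leaf i) = 0"
| "ccost E inc dm (Node l r) =
     ccost E inc dm l + ccost E inc dm r
     + pair_ops E inc dm (set (leaves l)) (set (leaves r))"

definition sphere_sep_const :: "'a::euclidean_space itself \<Rightarrow> real \<Rightarrow> bool" where
  "sphere_sep_const _ c \<longleftrightarrow>
    (\<forall>(n::nat) (k::nat) (ctr::nat \<Rightarrow> 'a) (rad::nat \<Rightarrow> real).
       k \<ge> 1 \<and> (\<forall>i<n. rad i > 0) \<and>
       (\<forall>x. card {i. i < n \<and> x \<in> cball (ctr i) (rad i)} \<le> k) \<longrightarrow>
       (\<exists>z \<rho>. \<rho> > 0 \<and>
          real (card {i. i < n \<and> cball (ctr i) (rad i) \<inter> sphere z \<rho> \<noteq> {}})
            \<le> c * real k powr (1 / real DIM('a)) * real n powr (1 - 1 / real DIM('a)) \<and>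
          real (card {i. i < n \<and> cball (ctr i) (rad i) \<subseteq> ball z \<rho>})
            \<le> (real DIM('a) + 1) / (real DIM('a) + 2) * real n \<and>
          real (card {i. i < n \<and> cball (ctr i) (rad i) \<inter> cball z \<rho> = {}})
            \<le> (real DIM('a) + 1) / (real DIM('a) + 2) * real n \<and>
          (\<forall>i j. i < n \<and> j < n \<and> cball (ctr i) (rad i) \<subseteq> ball z \<rho> \<and>
                 cball (ctr j) (rad j) \<inter> cball z \<rho> = {} \<longrightarrow>
                 cball (ctr i) (rad i) \<inter> cball (ctr j) (rad j) = {})))"

end

theory Submission
  imports Defs
begin

text \<open>
  Split the current set of \<open>m\<close> tensors recursively by a sphere separator. With logarithmic index weights,
  contracting the two parts costs the boundary inherited from above plus the new cut. Giving every
  separator tensor to the side it is more strongly tied to makes the cut at most half the separator's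
  total weight, and \<open>a m powr p\<close>, where \<open>p = 1 - 1/d\<close>, solves the resulting recursion if the parts
  have size at most \<open>\<alpha> m\<close>, where \<open>\<alpha> = (d + 1) / (d + 2)\<close>. The separator tensors may push the larger part above
  \<open>\<alpha> m\<close>, and for \<open>d \<ge> 3\<close> the resulting errors in the exponent are unbounded in \<open>n\<close>, so they
  cannot simply be absorbed. But a tensor joins the larger part only if its ties to that
  part are strictly stronger, and by integrality of the dimensions this saves at least
  \<open>1 / (2 M)\<close> in the cut, more than its \<open>O(m powr (p - 1))\<close> effect on the potential once \<open>m\<close> is large.
  Sets of bounded size are contracted sequentially at the price of a constant factor, which the
  spare power of \<open>n\<close> absorbs.
\<close>

section \<open>Logarithmic weights of index sets\<close>

locale sized_network =
  fixes n :: nat and E :: "nat set" and inc :: "nat \<Rightarrow> nat set" and dm :: "nat \<Rightarrow> nat" and M :: nat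
  assumes network: "tensor_network n E inc dm"
    and size_le: "\<And>i. i < n \<Longrightarrow> tensor_size inc dm i \<le> M"
    and M_ge_1: "M \<ge> 1"
begin

text \<open>Costs are products of dimensions; their logarithms add up over indices and can be
  compared with the sizes of cuts.\<close>

definition wt :: "nat set \<Rightarrow> real" where
  "wt F = (\<Sum>e\<in>F. ln (real (dm e)))"

text \<open>For disjoint \<open>S\<close> and \<open>T\<close> this is the cut between them. Phrased
  by existence instead of counting, it is monotone and distributes over unions in either
  argument.\<close>

definition shared :: "nat set \<Rightarrow> nat set \<Rightarrow> nat set" where
  "shared S T = {e \<in> E. (\<exists>i\<in>S. e \<in> inc i) \<and> (\<exists>j\<in>T. e \<in> inc j)}"

lemma finite_E: "finite E" and dm_pos: "e \<in> E \<Longrightarrow> dm e \<ge> 1"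
  and inc_subset: "i < n \<Longrightarrow> inc i \<subseteq> E"
  and card_ends: "e \<in> E \<Longrightarrow> card {i. i < n \<and> e \<in> inc i} = 2"
  using network by (auto simp: tensor_network_def)

text \<open>Two ends exhaust an index. Hence the indices that one tensor shares with disjoint groups
  of other tensors are disjoint.\<close>

lemma no_third_end:
  assumes "i < n" "j < n" "l < n" "i \<noteq> j" "i \<noteq> l" "j \<noteq> l"
    and "e \<in> inc i" "e \<in> inc j" "e \<in> inc l"
  shows False
proof -
  have e: "e \<in> E" using assms inc_subset by blast
  have "card {i, j, l} \<le> card {i. i < n \<and> e \<in> inc i}"
    by (rule card_mono) (use assms in auto)
  then show False using card_ends[OF e] assms by simp
qed

lemma wt_nonneg: "F \<subseteq> E \<Longrightarrow> 0 \<le> wt F"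
  unfolding wt_def using dm_pos by (intro sum_nonneg) force

lemma wt_mono: "F \<subseteq> G \<Longrightarrow> G \<subseteq> E \<Longrightarrow> wt F \<le> wt G"
  unfolding wt_def using dm_pos finite_E
  by (intro sum_mono2) (auto intro: finite_subset)

lemma wt_Un_le: "F \<subseteq> E \<Longrightarrow> G \<subseteq> E \<Longrightarrow> wt (F \<union> G) \<le> wt F + wt G"
  using finite_subset[OF _ finite_E] wt_nonneg[of "F \<inter> G"]
  unfolding wt_def by (subst sum_Un) auto

lemma wt_Un_disjoint: "F \<subseteq> E \<Longrightarrow> G \<subseteq> E \<Longrightarrow> F \<inter> G = {} \<Longrightarrow> wt (F \<union> G) = wt F + wt G"
  using finite_subset[OF _ finite_E] unfolding wt_def by (intro sum.union_disjoint) auto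

lemma wt_UN_le:
  assumes "finite I" "\<And>i. i \<in> I \<Longrightarrow> F i \<subseteq> E"
  shows "wt (\<Union>i\<in>I. F i) \<le> (\<Sum>i\<in>I. wt (F i))"
  using assms
proof (induction I)
  case empty
  then show ?case by (simp add: wt_def)
next
  case (insert i I)
  have "wt (F i \<union> \<Union> (F ` I)) \<le> wt (F i) + wt (\<Union> (F ` I))"
    using insert.prems by (intro wt_Un_le) auto
  also have "\<dots> \<le> wt (F i) + (\<Sum>i\<in>I. wt (F i))"
    using insert by simp
  finally show ?case using insert.hyps by simp
qed

lemma exp_wt:
  assumes "F \<subseteq> E" shows "exp (wt F) = real (\<Prod>e\<in>F. dm e)"
proof -
  have "finite F" using assms finite_E finite_subset by blast
  then have "exp (wt F) = (\<Prod>e\<in>F. exp (ln (real (dm e))))"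
    unfolding wt_def by (rule exp_sum)
  also have "\<dots> = (\<Prod>e\<in>F. real (dm e))"
    using assms dm_pos by (intro prod.cong) (auto intro!: exp_ln, force)
  finally show ?thesis by simp
qed

lemma prod_dm_pos: "F \<subseteq> E \<Longrightarrow> (\<Prod>e\<in>F. dm e) \<ge> 1"
  using dm_pos by (meson prod_ge_1 subsetD)

lemma wt_inc_le: assumes "i < n" shows "wt (inc i) \<le> ln (real M)"
proof -
  have "exp (wt (inc i)) \<le> real M"
    using exp_wt[OF inc_subset[OF assms]] size_le[OF assms] unfolding tensor_size_def by linarith
  then show ?thesis using M_ge_1 by (simp add: ln_ge_iff)
qed

text \<open>Weights are logarithms of integers up to \<open>M\<close>, so distinct ones differ by a definite amount.\<close>
lemma wt_gap:
  assumes "i < n" "F \<subseteq> inc i" "G \<subseteq> inc i" "wt G < wt F"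
  shows "wt F - wt G \<ge> 1 / real M"
proof -
  define a b where "a = (\<Prod>e\<in>F. dm e)" and "b = (\<Prod>e\<in>G. dm e)"
  have sub: "F \<subseteq> E" "G \<subseteq> E" using assms inc_subset by blast+
  have ab: "exp (wt F) = real a" "exp (wt G) = real b"
    using exp_wt sub by (auto simp: a_def b_def)
  have ge: "a \<ge> 1" "b \<ge> 1" using prod_dm_pos sub by (auto simp: a_def b_def)
  have "exp (wt F) \<le> exp (ln (real M))"
    using wt_mono[OF assms(2) inc_subset[OF assms(1)]] wt_inc_le[OF assms(1)] by simp
  then have aM: "a \<le> M" using ab M_ge_1 by simp
  have "b < a" using assms(4) ab by (metis exp_less_cancel_iff of_nat_less_iff)
  have "wt G - wt F = ln (real b / real a)"
    using ab ge by (metis exp_diff ln_exp)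
  also have "\<dots> \<le> real b / real a - 1" using ge by (intro ln_le_minus_one) auto
  also have "\<dots> = - ((real a - real b) / real a)" using ge by (simp add: field_simps)
  finally have "(real a - real b) / real a \<le> wt F - wt G" by simp
  \<comment> \<open>Integrality enters here: the numerator is at least 1, the denominator at most
    \<open>M\<close>.\<close>
  moreover have "1 / real M \<le> (real a - real b) / real a"
    using \<open>b < a\<close> ge aM by (intro frac_le) auto
  ultimately show ?thesis by linarith
qed

section \<open>Boundaries, cuts and the cost of one contraction\<close>

lemma shared_subset_E: "shared S T \<subseteq> E"
  by (auto simp: shared_def)

lemma open_idx_subset_E: "open_idx E inc S \<subseteq> E"
  by (auto simp: open_idx_def)

text \<open>An index outside \<open>shared S T\<close> has ends in at most one of the two sets, so
  adding the other set leaves its number of ends unchanged.\<close>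

lemma open_idx_Un_subset:
  "open_idx E inc S \<union> open_idx E inc T \<subseteq> open_idx E inc (S \<union> T) \<union> shared S T"
proof
  fix e assume "e \<in> open_idx E inc S \<union> open_idx E inc T"
  then have e: "e \<in> E" and c: "card {i \<in> S. e \<in> inc i} = 1 \<or> card {i \<in> T. e \<in> inc i} = 1"
    by (auto simp: open_idx_def)
  show "e \<in> open_idx E inc (S \<union> T) \<union> shared S T"
  proof (cases "e \<in> shared S T")
    case False
    then have "{i \<in> S. e \<in> inc i} = {} \<or> {i \<in> T. e \<in> inc i} = {}"
      using e by (auto simp: shared_def)
    then have "{i \<in> S \<union> T. e \<in> inc i} = {i \<in> S. e \<in> inc i} \<and> {i \<in> T. e \<in> inc i} = {}
      \<or> {i \<in> S \<union> T. e \<in> inc i} = {i \<in> T. e \<in> inc i} \<and> {i \<in> S. e \<in> inc i} = {}"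
      by blast
    then have "card {i \<in> S \<union> T. e \<in> inc i} = 1"
      using c by (elim disjE conjE) simp_all
    then show ?thesis using e by (simp add: open_idx_def)
  qed simp
qed

text \<open>The left side is the logarithm of the number of multiplications for \<open>S\<close>
  with \<open>T\<close>; the right side splits it into the inherited boundary and the new
  cut.\<close>

lemma wt_open_Un_le:
  "wt (open_idx E inc S \<union> open_idx E inc T) \<le> wt (open_idx E inc (S \<union> T)) + wt (shared S T)"
  by (rule order_trans[OF wt_mono[OF open_idx_Un_subset] wt_Un_le])
    (auto simp: shared_subset_E open_idx_subset_E)

text \<open>The factor 2 covers the additions: dropping the \<open>- 1\<close> turns their number
  into the number of multiplications.\<close>

lemma pair_ops_le:
  "real (pair_ops E inc dm S T) \<le> 2 * exp (wt (open_idx E inc S \<union> open_idx E inc T))"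
proof -
  define A B where "A = open_idx E inc S" and "B = open_idx E inc T"
  have sub: "A \<subseteq> E" "B \<subseteq> E" by (auto simp: A_def B_def open_idx_subset_E)
  have fin: "finite A" "finite B" using sub finite_E finite_subset by blast+
  have "(\<Prod>e\<in>(A \<union> B) - (A \<inter> B). dm e) * ((\<Prod>e\<in>A \<inter> B. dm e) - 1)
      \<le> (\<Prod>e\<in>(A \<union> B) - (A \<inter> B). dm e) * (\<Prod>e\<in>A \<inter> B. dm e)"
    by simp
  also have "\<dots> = (\<Prod>e\<in>A \<union> B. dm e)"
    by (rule prod.subset_diff[symmetric]) (use fin in auto)
  finally have "pair_ops E inc dm S T \<le> 2 * (\<Prod>e\<in>A \<union> B. dm e)"
    by (simp add: pair_ops_def Let_def A_def B_def)
  then have "real (pair_ops E inc dm S T) \<le> 2 * real (\<Prod>e\<in>A \<union> B. dm e)"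
    by (metis of_nat_le_iff of_nat_mult of_nat_numeral)
  also have "\<dots> = 2 * exp (wt (A \<union> B))"
    using exp_wt[of "A \<union> B"] sub by simp
  finally show ?thesis by (simp add: A_def B_def)
qed

section \<open>Cost of contraction trees and the recursion over separators\<close>

text \<open>A tree on \<open>S\<close> performs \<open>card S - 1\<close> contractions; the bound is
  the one obtained if each costs at most \<open>2 * exp z\<close>.\<close>

definition contractible :: "nat set \<Rightarrow> real \<Rightarrow> bool" where
  "contractible S z \<longleftrightarrow> (\<exists>t. distinct (leaves t) \<and> set (leaves t) = S \<and>
     real (ccost E inc dm t) \<le> 2 * (real (card S) - 1) * exp z)"

lemma contractible_singleton: "contractible {i} z"
  unfolding contractible_def by (rule exI[of _ "Leaf i"]) simp

lemma contractible_mono: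
  assumes "contractible S z" "z \<le> z'" "finite S" "S \<noteq> {}"
  shows "contractible S z'"
proof -
  have "card S \<ge> 1" using assms by (simp add: Suc_leI card_gt_0_iff)
  then have "2 * (real (card S) - 1) * exp z \<le> 2 * (real (card S) - 1) * exp z'"
    using assms(2) by (intro mult_left_mono) auto
  then show ?thesis using assms(1) unfolding contractible_def by (blast intro: order_trans)
qed

text \<open>The counts \<open>card S - 1\<close> and \<open>card T - 1\<close>, plus one for joining
  the two results, give \<open>card (S \<union> T) - 1\<close>.\<close>

lemma contractible_Un:
  assumes "contractible S z" "contractible T z" "S \<inter> T = {}" "finite S" "finite T"
    and "wt (open_idx E inc S \<union> open_idx E inc T) \<le> z"
  shows "contractible (S \<union> T) z"
proof -
  obtain s where s: "distinct (leaves s)" "set (leaves s) = S"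
    "real (ccost E inc dm s) \<le> 2 * (real (card S) - 1) * exp z"
    using assms(1) by (auto simp: contractible_def)
  obtain t where t: "distinct (leaves t)" "set (leaves t) = T"
    "real (ccost E inc dm t) \<le> 2 * (real (card T) - 1) * exp z"
    using assms(2) by (auto simp: contractible_def)
  have "real (pair_ops E inc dm S T) \<le> 2 * exp z"
    by (rule order_trans[OF pair_ops_le]) (use assms(6) in simp)
  moreover have "card (S \<union> T) = card S + card T" using assms by (intro card_Un_disjoint)
  ultimately have "real (ccost E inc dm (Node s t)) \<le> 2 * (real (card (S \<union> T)) - 1) * exp z"
    using s t by (simp add: algebra_simps)
  then show ?thesis unfolding contractible_def
    using s t assms(3) by (intro exI[of _ "Node s t"]) auto
qed

text \<open>The budgets \<open>x\<close>, \<open>y\<close>, \<open>z\<close> are measured above the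
  boundary of the respective set. The boundary of either part is at most the outer boundary plus the
  cut, so \<open>z\<close> has to pay for the cut; \<open>0 \<le> x\<close> lets it cover the final
  contraction too.\<close>

lemma contractible_split:
  assumes "S \<subseteq> {..<n}" "T \<subseteq> {..<n}" "S \<inter> T = {}" "S \<noteq> {}" "T \<noteq> {}"
    and "contractible S (wt (open_idx E inc S) + x)" "contractible T (wt (open_idx E inc T) + y)"
    and "wt (shared S T) + x \<le> z" "wt (shared S T) + y \<le> z" "0 \<le> x"
  shows "contractible (S \<union> T) (wt (open_idx E inc (S \<union> T)) + z)"
proof -
  have fin: "finite S" "finite T" using assms finite_subset by blast+
  define u where "u = wt (open_idx E inc S \<union> open_idx E inc T)"
  have u: "u \<le> wt (open_idx E inc (S \<union> T)) + wt (shared S T)"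
    unfolding u_def by (rule wt_open_Un_le)
  have "wt (open_idx E inc S) \<le> u" "wt (open_idx E inc T) \<le> u"
    unfolding u_def by (auto intro!: wt_mono dest: subsetD[OF open_idx_subset_E])
  then show ?thesis
    using assms fin u
    by (intro contractible_Un contractible_mono[OF assms(6)] contractible_mono[OF assms(7)])
      (auto simp flip: u_def)
qed

text \<open>Attaching one tensor at a time creates a cut of weight at most \<open>ln M\<close> each
  time. This crude linear budget serves sets of bounded size.\<close>

lemma contractible_sequential:
  assumes "S \<subseteq> {..<n}" "S \<noteq> {}"
  shows "contractible S (wt (open_idx E inc S) + real (card S) * ln (real M))"
proof -
  have "finite S" using assms finite_subset by blast
  from this assms(2,1) show ?thesis
  proof (induction S rule: finite_ne_induct)
    case (singleton i)
    show ?case by (rule contractible_singleton)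
  next
    case (insert i S)
    have "wt (shared {i} S) \<le> wt (inc i)"
      using insert.prems inc_subset by (intro wt_mono) (auto simp: shared_def)
    also have "\<dots> \<le> ln (real M)" using insert.prems by (intro wt_inc_le) auto
    finally have w: "wt (shared {i} S) \<le> ln (real M)" .
    have "0 \<le> real (card S) * ln (real M)" using M_ge_1 by simp
    then have "contractible ({i} \<union> S) (wt (open_idx E inc ({i} \<union> S)) + real (card (insert i S)) * ln (real M))"
      using insert w contractible_singleton
      by (intro contractible_split[where x = 0 and y = "real (card S) * ln (real M)"])
        (auto simp: algebra_simps)
    then show ?case by simp
  qed
qed

text \<open>Each separator vertex joins the side it is more strongly tied to, ties going to \<open>B\<close>; an index
  inside the separator is charged half to either end, so a vertex is charged at most half of its
  total weight, and noticeably less whenever it enlarges \<open>A\<close>.\<close>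
lemma split_separator:
  assumes sub: "A \<subseteq> {..<n}" "B \<subseteq> {..<n}" "Q \<subseteq> {..<n}"
    and dis: "A \<inter> B = {}" "A \<inter> Q = {}" "B \<inter> Q = {}"
    and sep: "shared A B = {}"
  obtains R where "R \<subseteq> Q"
    "wt (shared (A \<union> R) (B \<union> (Q - R))) \<le> real (card Q) * ln (real M) / 2 - real (card R) / (2 * real M)"
proof
  define R where "R = {q \<in> Q. wt (shared B {q}) < wt (shared A {q})}"
  show R: "R \<subseteq> Q" by (auto simp: R_def)
  define L where "L = Q - R"
  have fin: "finite Q" "finite R" "finite L"
    using sub R finite_subset[of _ "{..<n}"] unfolding L_def by (meson finite_Diff finite_lessThan finite_subset)+
  have QRL: "Q = R \<union> L" "R \<inter> L = {}" using R by (auto simp: L_def)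
  \<comment> \<open>The three index sets are disjoint parts of \<open>inc q\<close>, since an index
    in two of them would have three ends.\<close>
  have total: "wt (shared A {q}) + wt (shared B {q}) + wt (shared {q} (Q - {q})) \<le> ln (real M)"
    if "q \<in> Q" for q
  proof -
    have q: "q < n" "q \<notin> A" "q \<notin> B" using that sub dis by auto
    have third: False
      if "e \<in> inc i" "e \<in> inc j" "e \<in> inc q" "i \<in> A \<union> B \<union> Q" "j \<in> A \<union> B \<union> Q" "i \<noteq> j" "i \<noteq> q" "j \<noteq> q" for e i j
      by (rule no_third_end[of i j q e]) (use that sub q(1) in auto)
    have d1: "shared A {q} \<inter> shared B {q} = {}"
    proof (intro equalityI subsetI)
      fix e assume "e \<in> shared A {q} \<inter> shared B {q}"
      then obtain i j where "i \<in> A" "j \<in> B" "e \<in> inc i" "e \<in> inc j" "e \<in> inc q"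
        by (auto simp: shared_def)
      then show "e \<in> {}" using third[of e i j] q dis by blast
    qed simp
    have d2: "(shared A {q} \<union> shared B {q}) \<inter> shared {q} (Q - {q}) = {}"
    proof (intro equalityI subsetI)
      fix e assume "e \<in> (shared A {q} \<union> shared B {q}) \<inter> shared {q} (Q - {q})"
      then obtain i j where "i \<in> A \<union> B" "j \<in> Q - {q}" "e \<in> inc i" "e \<in> inc j" "e \<in> inc q"
        by (auto simp: shared_def)
      then show "e \<in> {}" using third[of e i j] q dis by blast
    qed simp
    have "wt (shared A {q}) + wt (shared B {q}) + wt (shared {q} (Q - {q}))
        = wt (shared A {q} \<union> shared B {q} \<union> shared {q} (Q - {q}))"
      using d1 d2 by (simp add: wt_Un_disjoint shared_subset_E)
    also have "\<dots> \<le> wt (inc q)"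
      using inc_subset[OF q(1)] by (intro wt_mono) (auto simp: shared_def)
    also have "\<dots> \<le> ln (real M)" by (rule wt_inc_le[OF q(1)])
    finally show ?thesis .
  qed
  \<comment> \<open>The weaker tie lies below the average of both by half their difference, so the
    gap \<open>1 / M\<close> saves \<open>1 / (2 * M)\<close>.\<close>
  have chR: "wt (shared B {q}) + wt (shared {q} L) / 2 \<le> ln (real M) / 2 - 1 / (2 * real M)"
    if "q \<in> R" for q
  proof -
    have q: "q \<in> Q" "q < n" "wt (shared B {q}) < wt (shared A {q})"
      using that sub by (auto simp: R_def)
    have "wt (shared {q} L) \<le> wt (shared {q} (Q - {q}))"
      using that by (intro wt_mono) (auto simp: shared_def L_def)
    moreover have "wt (shared A {q}) - wt (shared B {q}) \<ge> 1 / real M"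
      using q by (intro wt_gap[of q]) (auto simp: shared_def)
    moreover have "1 / (2 * real M) = (1 / real M) / 2" by simp
    ultimately show ?thesis using total[OF q(1)] by linarith
  qed
  have chL: "wt (shared A {q}) + wt (shared {q} R) / 2 \<le> ln (real M) / 2"
    if "q \<in> L" for q
  proof -
    have q: "q \<in> Q" "wt (shared A {q}) \<le> wt (shared B {q})"
      using that by (auto simp: R_def L_def)
    have "wt (shared {q} R) \<le> wt (shared {q} (Q - {q}))"
      using that R by (intro wt_mono) (auto simp: shared_def L_def)
    then show ?thesis using total[OF q(1)] q(2) by linarith
  qed
  \<comment> \<open>The cut inside the separator is bounded from either end; averaging both bounds
    charges half of it to each side.\<close>
  have RL1: "wt (shared R L) \<le> (\<Sum>q\<in>R. wt (shared {q} L))"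
    by (rule order_trans[OF wt_mono wt_UN_le])
      (use fin in \<open>auto simp: shared_def\<close>)
  have RL2: "wt (shared R L) \<le> (\<Sum>q\<in>L. wt (shared {q} R))"
    by (rule order_trans[OF wt_mono wt_UN_le])
      (use fin in \<open>auto simp: shared_def\<close>)
  have AL: "wt (shared A L) \<le> (\<Sum>q\<in>L. wt (shared A {q}))"
    by (rule order_trans[OF wt_mono wt_UN_le])
      (use fin in \<open>auto simp: shared_def\<close>)
  have BR: "wt (shared B R) \<le> (\<Sum>q\<in>R. wt (shared B {q}))"
    by (rule order_trans[OF wt_mono wt_UN_le])
      (use fin in \<open>auto simp: shared_def\<close>)
  have "shared (A \<union> R) (B \<union> L) \<subseteq> shared A B \<union> (shared B R \<union> (shared A L \<union> shared R L))"
    by (auto simp: shared_def)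
  then have "wt (shared (A \<union> R) (B \<union> L)) \<le> wt (shared B R \<union> (shared A L \<union> shared R L))"
    using sep shared_subset_E by (intro wt_mono) auto
  also have "\<dots> \<le> wt (shared B R) + (wt (shared A L) + wt (shared R L))"
    using shared_subset_E by (intro order_trans[OF wt_Un_le] add_left_mono wt_Un_le) auto
  also have "\<dots> \<le> (\<Sum>q\<in>R. wt (shared B {q})) + (\<Sum>q\<in>R. wt (shared {q} L)) / 2
      + ((\<Sum>q\<in>L. wt (shared A {q})) + (\<Sum>q\<in>L. wt (shared {q} R)) / 2)"
    using RL1 RL2 AL BR by linarith
  also have "\<dots> = (\<Sum>q\<in>R. wt (shared B {q}) + wt (shared {q} L) / 2)
      + (\<Sum>q\<in>L. wt (shared A {q}) + wt (shared {q} R) / 2)"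
    by (simp add: sum.distrib sum_divide_distrib)
  also have "\<dots> \<le> (\<Sum>q\<in>R. ln (real M) / 2 - 1 / (2 * real M)) + (\<Sum>q\<in>L. ln (real M) / 2)"
    by (intro add_mono sum_mono chR chL)
  also have "\<dots> = (real (card R) + real (card L)) * ln (real M) / 2 - real (card R) / (2 * real M)"
    by (simp add: algebra_simps add_divide_distrib)
  also have "real (card R) + real (card L) = real (card Q)"
    using card_Un_disjoint[OF fin(2,3) QRL(2)] QRL(1) by simp
  finally show "wt (shared (A \<union> R) (B \<union> (Q - R)))
      \<le> real (card Q) * ln (real M) / 2 - real (card R) / (2 * real M)"
    by (simp add: L_def)
qed

text \<open>The vertices added to \<open>A\<close> raise the potential \<open>a x powr p\<close> by less than what they save in the
  cut, once the set is large.\<close>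
lemma contractible_by_separators:
  fixes \<alpha> p C :: real and m\<^sub>0 :: nat
  assumes separable: "\<And>S. S \<subseteq> {..<n} \<Longrightarrow> \<exists>A B Q. S = A \<union> B \<union> Q \<and> A \<inter> B = {} \<and> A \<inter> Q = {} \<and> B \<inter> Q = {}
        \<and> shared A B = {} \<and> card B \<le> card A \<and> real (card A) \<le> \<alpha> * real (card S)
        \<and> real (card Q) \<le> C * real (card S) powr p"
    and \<alpha>: "3 / 4 \<le> \<alpha>" "\<alpha> < 1" and p: "0 < p" "p \<le> 1" and C: "0 \<le> C"
    and a: "a = C / (2 - 2 * \<alpha> powr p)"
    and small_sep: "\<And>m. m > m\<^sub>0 \<Longrightarrow> C * real m powr p < (1 - \<alpha>) * real m"
    and small_slope: "\<And>m. m > m\<^sub>0 \<Longrightarrow> a * ln (real M) * (\<alpha> * real m) powr (p - 1) \<le> 1 / (2 * real M)"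
    and S: "S \<subseteq> {..<n}" "S \<noteq> {}"
  shows "contractible S (wt (open_idx E inc S) + (a * real (card S) powr p + real m\<^sub>0) * ln (real M))"
  using S
proof (induction "card S" arbitrary: S rule: less_induct)
  case less
  define m where "m = card S"
  have finS: "finite S" using less.prems finite_subset by blast
  have lnM: "ln (real M) \<ge> 0" using M_ge_1 by simp
  have \<alpha>p: "\<alpha> powr p < 1" using \<alpha> p powr_less_mono2[of p \<alpha> 1] by simp
  then have a0: "a \<ge> 0" using a C by simp
  show ?case
  proof (cases "m \<le> m\<^sub>0")
    case True
    have "0 \<le> a * real m powr p * ln (real M)" using a0 lnM by simp
    moreover have "real m * ln (real M) \<le> real m\<^sub>0 * ln (real M)"
      using True lnM by (intro mult_right_mono) auto
    ultimately show ?thesis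
      using contractible_sequential[OF less.prems] finS less.prems
      by (intro contractible_mono[OF contractible_sequential[OF less.prems]])
        (auto simp: m_def algebra_simps)
  next
    case False
    then have big: "m > m\<^sub>0" and m0: "real m > 0" by auto
    obtain A B Q where S_eq: "S = A \<union> B \<union> Q" and dis: "A \<inter> B = {}" "A \<inter> Q = {}" "B \<inter> Q = {}"
      and sep: "shared A B = {}" and BA: "card B \<le> card A"
      and cA: "real (card A) \<le> \<alpha> * real m" and cQ: "real (card Q) \<le> C * real m powr p"
      using separable[OF less.prems(1)] unfolding m_def by blast
    have fin: "finite A" "finite B" "finite Q" using finS S_eq by auto
    obtain R where R: "R \<subseteq> Q" and cut: "wt (shared (A \<union> R) (B \<union> (Q - R)))
        \<le> real (card Q) * ln (real M) / 2 - real (card R) / (2 * real M)"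
      using split_separator[of A B Q] less.prems(1) dis sep unfolding S_eq by blast
    define S1 S2 where "S1 = A \<union> R" and "S2 = B \<union> (Q - R)"
    have S12: "S = S1 \<union> S2" "S1 \<inter> S2 = {}"
      using R dis by (auto simp: S_eq S1_def S2_def)
    have fin12: "finite S1" "finite S2" using finS S12 by auto
    have cardS: "m = card S1 + card S2"
      unfolding m_def S12(1) by (rule card_Un_disjoint[OF fin12 S12(2)])
    have cR: "card R \<le> card Q" using R fin by (simp add: card_mono)
    have c1: "card S1 \<le> card A + card R" unfolding S1_def by (rule card_Un_le)
    have c2: "card S2 \<le> card B + card Q" unfolding S2_def
      using card_Un_le[of B "Q - R"] card_mono[of Q "Q - R"] fin by force
    have "m = card A + card B + card Q"
      unfolding m_def S_eq using fin dis by (simp add: card_Un_disjoint Int_Un_distrib2)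
    then have cB: "real (card B) \<le> real m / 2" using BA by simp
    have sep_lt: "C * real m powr p < (1 - \<alpha>) * real m" by (rule small_sep[OF big])
    \<comment> \<open>\<open>S1\<close> may exceed \<open>\<alpha> * m\<close>; the induction only
      needs it to be smaller than \<open>S\<close>.\<close>
    have l1: "real (card S1) < real m"
      using c1 cR cA cQ sep_lt by (simp add: algebra_simps)
    have l2: "real (card S2) \<le> \<alpha> * real m"
    proof -
      \<comment> \<open>As \<open>\<alpha> \<ge> 3 / 4\<close>, the smaller side, at most half of
        \<open>S\<close>, stays within \<open>\<alpha> * m\<close> even if it receives the whole
        separator.\<close>
      have "(1 - \<alpha>) * real m \<le> (\<alpha> - 1 / 2) * real m" using \<alpha> m0 by (intro mult_right_mono) auto
      then show ?thesis using c2 cB cQ sep_lt by (simp add: algebra_simps)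
    qed
    also have "\<alpha> * real m < real m" using \<alpha> m0 by simp
    finally have l2': "real (card S2) < real m" .
    have ne: "S1 \<noteq> {}" "S2 \<noteq> {}" using l1 l2' cardS by auto
    \<comment> \<open>This equation determines \<open>a\<close>: half the separator bound plus the
      potential at \<open>\<alpha> * m\<close> is the potential at \<open>m\<close>.\<close>
    have bal: "C / 2 * real m powr p + a * (\<alpha> * real m) powr p = a * real m powr p"
    proof -
      have "C / 2 = a * (1 - \<alpha> powr p)" using a \<alpha>p by (simp add: field_simps)
      then have "C / 2 * real m powr p + a * \<alpha> powr p * real m powr p = a * real m powr p"
        by (simp only: distrib_right[symmetric]) (simp add: right_diff_distrib)
      then show ?thesis by (simp add: powr_mult)
    qed
    have cutQ: "real (card Q) * ln (real M) / 2 \<le> C / 2 * real m powr p * ln (real M)"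
      using mult_right_mono[OF cQ lnM] by simp
    have cut': "wt (shared S1 S2) \<le> C / 2 * real m powr p * ln (real M) - real (card R) / (2 * real M)"
      using cut cutQ by (simp add: S1_def S2_def)
    have "real (card R) / (2 * real M) \<ge> 0" by simp
    have f2: "wt (shared S1 S2) + a * real (card S2) powr p * ln (real M) \<le> a * real m powr p * ln (real M)"
    proof -
      have "a * real (card S2) powr p * ln (real M) \<le> a * (\<alpha> * real m) powr p * ln (real M)"
        using a0 lnM l2 p by (intro mult_right_mono mult_left_mono powr_mono2) auto
      moreover have "C / 2 * real m powr p * ln (real M) + a * (\<alpha> * real m) powr p * ln (real M)
          = a * real m powr p * ln (real M)"
        using arg_cong[OF bal, of "\<lambda>y. y * ln (real M)"] by (simp only: distrib_right)
      ultimately show ?thesis using cut' \<open>real (card R) / (2 * real M) \<ge> 0\<close> by linarith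
    qed
    have f1: "wt (shared S1 S2) + a * real (card S1) powr p * ln (real M) \<le> a * real m powr p * ln (real M)"
    proof -
      define x u where "x = \<alpha> * real m" and "u = real (card R)"
      have x: "x > 0" "u \<ge> 0" using \<alpha> m0 by (auto simp: x_def u_def)
      have "real (card S1) powr p \<le> (x + u) powr p"
        using c1 cA p by (intro powr_mono2) (auto simp: x_def u_def)
      also have "x + u = x * (1 + u / x)" using x by (simp add: distrib_left)
      also have "(x * (1 + u / x)) powr p = x powr p * (1 + u / x) powr p" by (rule powr_mult)
      \<comment> \<open>Since the base is at least 1 and \<open>p \<le> 1\<close>, raising the
        exponent to 1 gives a bound linear in \<open>u\<close>.\<close>
      also have "\<dots> \<le> x powr p * (1 + u / x) powr 1"
        using x p by (intro mult_left_mono powr_mono) auto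
      also have "\<dots> = x powr p + u * x powr (p - 1)"
        using x by (simp add: powr_diff field_simps)
      finally have "a * real (card S1) powr p * ln (real M) \<le> a * (x powr p + u * x powr (p - 1)) * ln (real M)"
        using a0 lnM by (intro mult_right_mono mult_left_mono) auto
      also have "\<dots> = a * x powr p * ln (real M) + u * (a * ln (real M) * x powr (p - 1))"
        by (simp add: algebra_simps)
      \<comment> \<open>Each vertex of \<open>R\<close> now costs at most
        \<open>1 / (2 * M)\<close>, exactly what it saves in \<open>cut'\<close>.\<close>
      also have "\<dots> \<le> a * x powr p * ln (real M) + u * (1 / (2 * real M))"
        using small_slope[OF big] x by (intro add_left_mono mult_left_mono) (auto simp: x_def)
      finally have "a * real (card S1) powr p * ln (real M) \<le> a * x powr p * ln (real M) + u / (2 * real M)"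
        by simp
      moreover have "C / 2 * real m powr p * ln (real M) + a * x powr p * ln (real M)
          = a * real m powr p * ln (real M)"
        using arg_cong[OF bal, of "\<lambda>y. y * ln (real M)"] by (simp only: distrib_right x_def)
      ultimately show ?thesis using cut' unfolding u_def by linarith
    qed
    have sub12: "S1 \<subseteq> {..<n}" "S2 \<subseteq> {..<n}" using less.prems S12 by auto
    have "contractible (S1 \<union> S2) (wt (open_idx E inc (S1 \<union> S2)) + (a * real m powr p + real m\<^sub>0) * ln (real M))"
    proof (rule contractible_split)
      show "contractible S1 (wt (open_idx E inc S1) + (a * real (card S1) powr p + real m\<^sub>0) * ln (real M))"
        using less.hyps[of S1] l1 sub12 ne by (simp add: m_def)
      show "contractible S2 (wt (open_idx E inc S2) + (a * real (card S2) powr p + real m\<^sub>0) * ln (real M))"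
        using less.hyps[of S2] l2' sub12 ne by (simp add: m_def)
      show "0 \<le> (a * real (card S1) powr p + real m\<^sub>0) * ln (real M)" using a0 lnM by simp
    qed (use S12 sub12 ne f1 f2 in \<open>auto simp: distrib_right\<close>)
    then show ?thesis using S12(1) by (simp add: m_def)
  qed
qed

end

section \<open>From sphere separators to separators of sets of tensors\<close>

text \<open>A ball that meets the open ball without lying in it crosses the frontier by
  connectedness. Thus all balls neither inside nor outside are counted by the separator
  bound.\<close>

lemma cball_meets_sphere:
  fixes x z :: "'a::euclidean_space"
  assumes "\<not> cball x r \<subseteq> ball z \<rho>" "cball x r \<inter> cball z \<rho> \<noteq> {}" "\<rho> > 0"
  shows "cball x r \<inter> sphere z \<rho> \<noteq> {}"
proof (cases "cball x r \<inter> ball z \<rho> = {}")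
  case True
  then show ?thesis using assms(2) by (force simp: not_less)
next
  case False
  then have "cball x r \<inter> frontier (ball z \<rho>) \<noteq> {}"
    using assms(1) by (intro connected_Int_frontier) (auto intro: convex_connected)
  then show ?thesis using assms(3) by simp
qed

text \<open>The bound on overlaps passes to subfamilies, so the separator property applies to an
  enumeration \<open>h\<close> of \<open>S\<close>. Inside and outside play symmetric roles, and the
  larger one is named \<open>A\<close>.\<close>

lemma sphere_separator_subset:
  fixes ctr :: "nat \<Rightarrow> 'a::euclidean_space"
  assumes sep: "sphere_sep_const TYPE('a) c" and "k \<ge> 1" and S: "S \<subseteq> {..<n}"
    and rad: "\<And>i. i < n \<Longrightarrow> rad i > 0"
    and ply: "\<And>x. card {i. i < n \<and> x \<in> cball (ctr i) (rad i)} \<le> k"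
  obtains A B Q where "S = A \<union> B \<union> Q" "A \<inter> B = {}" "A \<inter> Q = {}" "B \<inter> Q = {}"
    "\<And>i j. i \<in> A \<Longrightarrow> j \<in> B \<Longrightarrow> cball (ctr i) (rad i) \<inter> cball (ctr j) (rad j) = {}"
    "card B \<le> card A"
    "real (card A) \<le> (real DIM('a) + 1) / (real DIM('a) + 2) * real (card S)"
    "real (card Q) \<le> c * real k powr (1 / real DIM('a)) * real (card S) powr (1 - 1 / real DIM('a))"
proof -
  have finS: "finite S" using S finite_subset by blast
  define m where "m = card S"
  obtain h where h: "bij_betw h {..<m} S"
    using ex_bij_betw_nat_finite[OF finS] by (auto simp: m_def atLeast0LessThan)
  have hS: "h i \<in> S" "h i < n" if "i < m" for i
    using h S that by (auto simp: bij_betw_def)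
  have card_h: "card {i. i < m \<and> P (h i)} = card {j \<in> S. P j}" for P
  proof -
    have "h ` {i. i < m \<and> P (h i)} = {j \<in> S. P j}"
      using h by (auto simp: bij_betw_def)
    moreover have "inj_on h {i. i < m \<and> P (h i)}"
      using h by (auto simp: bij_betw_def intro: inj_on_subset)
    ultimately show ?thesis by (metis card_image)
  qed
  let ?b = "\<lambda>i. cball (ctr i) (rad i)"
  have ply': "card {i. i < m \<and> x \<in> ?b (h i)} \<le> k" for x
  proof -
    have "card {j \<in> S. x \<in> ?b j} \<le> card {i. i < n \<and> x \<in> ?b i}"
      using S by (intro card_mono) auto
    then show ?thesis using ply[of x] card_h[of "\<lambda>j. x \<in> ?b j"] by simp
  qed
  let ?\<alpha> = "(real DIM('a) + 1) / (real DIM('a) + 2)"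
  have "k \<ge> 1 \<and> (\<forall>i<m. rad (h i) > 0) \<and> (\<forall>x. card {i. i < m \<and> x \<in> ?b (h i)} \<le> k)"
    using \<open>k \<ge> 1\<close> ply' rad hS by simp
  from sep[unfolded sphere_sep_const_def, rule_format, OF this]
  obtain z \<rho> where \<rho>: "\<rho> > 0"
    and "real (card {i. i < m \<and> ?b (h i) \<inter> sphere z \<rho> \<noteq> {}})
        \<le> c * real k powr (1 / real DIM('a)) * real m powr (1 - 1 / real DIM('a))"
    and "real (card {i. i < m \<and> ?b (h i) \<subseteq> ball z \<rho>}) \<le> ?\<alpha> * real m"
    and "real (card {i. i < m \<and> ?b (h i) \<inter> cball z \<rho> = {}}) \<le> ?\<alpha> * real m"
    by (elim exE conjE)
  then have q: "real (card {j \<in> S. ?b j \<inter> sphere z \<rho> \<noteq> {}})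
        \<le> c * real k powr (1 / real DIM('a)) * real m powr (1 - 1 / real DIM('a))"
    and a: "real (card {j \<in> S. ?b j \<subseteq> ball z \<rho>}) \<le> ?\<alpha> * real m"
    and b: "real (card {j \<in> S. ?b j \<inter> cball z \<rho> = {}}) \<le> ?\<alpha> * real m"
    by (simp_all only: card_h[of "\<lambda>j. ?b j \<inter> sphere z \<rho> \<noteq> {}"]
      card_h[of "\<lambda>j. ?b j \<subseteq> ball z \<rho>"] card_h[of "\<lambda>j. ?b j \<inter> cball z \<rho> = {}"])
  define A B Q where "A = {j \<in> S. ?b j \<subseteq> ball z \<rho>}" and "B = {j \<in> S. ?b j \<inter> cball z \<rho> = {}}"
    and "Q = S - A - B"
  have "card Q \<le> card {j \<in> S. ?b j \<inter> sphere z \<rho> \<noteq> {}}"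
    using finS cball_meets_sphere[OF _ _ \<rho>]
    by (intro card_mono) (auto simp: A_def B_def Q_def)
  then have cQ: "real (card Q) \<le> c * real k powr (1 / real DIM('a)) * real (card S) powr (1 - 1 / real DIM('a))"
    using q by (simp add: m_def)
  have AB: "A \<inter> B = {}"
  proof -
    \<comment> \<open>An empty ball would count as both inside and outside; positive radii exclude
      this.\<close>
    have "ctr j \<in> ?b j" if "j \<in> S" for j using that S rad[of j] by auto
    then show ?thesis unfolding A_def B_def using ball_subset_cball by blast
  qed
  have dj: "?b i \<inter> ?b j = {}" if "i \<in> A" "j \<in> B" for i j
    using that unfolding A_def B_def using ball_subset_cball by blast
  have un: "S = A \<union> B \<union> Q" "A \<inter> Q = {}" "B \<inter> Q = {}" by (auto simp: A_def B_def Q_def)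
  have cA: "real (card A) \<le> ?\<alpha> * real (card S)" and cB: "real (card B) \<le> ?\<alpha> * real (card S)"
    using a b by (simp_all only: A_def B_def m_def)
  show ?thesis
  proof (cases "card B \<le> card A")
    case True
    show ?thesis by (rule that[OF un(1) AB un(2,3) dj True cA cQ])
  next
    case False
    have "S = B \<union> A \<union> Q" "B \<inter> A = {}" using un(1) AB by blast+
    moreover have "?b i \<inter> ?b j = {}" if "i \<in> B" "j \<in> A" for i j
      using dj[OF that(2,1)] by blast
    ultimately show ?thesis using that[of B A Q] un(2,3) False cB cQ by simp
  qed
qed

text \<open>For a single unit ball with \<open>k = 1\<close> the separator bound is \<open>c\<close>
  itself, and it bounds a cardinality.\<close>

lemma sphere_sep_const_nonneg:
  assumes "sphere_sep_const TYPE('a::euclidean_space) c" shows "c \<ge> 0"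
proof -
  obtain A B Q :: "nat set" where
    "real (card Q) \<le> c * real 1 powr (1 / real DIM('a)) * real (card {0::nat}) powr (1 - 1 / real DIM('a))"
  proof (rule sphere_separator_subset[OF assms, of 1 "{0}" 1 "\<lambda>_. 1" "\<lambda>_. 0"])
    show "card {i. i < 1 \<and> x \<in> cball ((\<lambda>_::nat. 0) i) ((\<lambda>_. 1) i)} \<le> 1" for x :: 'a
      using card_mono[of "{..<1::nat}" "{i. i < 1 \<and> x \<in> cball 0 1}"] by auto
  qed auto
  then have "real (card Q) \<le> c" by simp
  then show ?thesis using of_nat_0_le_iff order_trans by blast
qed

section \<open>Choice of thresholds and the bound for large networks\<close>

theorem theorem1:
  fixes c :: real and k M :: nat
  assumes "DIM('a::euclidean_space) \<ge> 2"
    and "k \<ge> 1" and "M \<ge> 2"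
    and "sphere_sep_const TYPE('a) c"
  shows "\<exists>N::nat. \<forall>n \<ge> N. \<forall>E inc dm (ctr :: nat \<Rightarrow> 'a) rad.
     tensor_network n E inc dm \<and>
     (\<forall>i<n. tensor_size inc dm i \<le> M) \<and>
     (\<forall>i<n. rad i > 0) \<and>
     (\<forall>e\<in>E. \<forall>i<n. \<forall>j<n. i \<noteq> j \<and> e \<in> inc i \<and> e \<in> inc j \<longrightarrow>
         cball (ctr i) (rad i) \<inter> cball (ctr j) (rad j) \<noteq> {}) \<and>
     (\<forall>x. card {i. i < n \<and> x \<in> cball (ctr i) (rad i)} \<le> k)
     \<longrightarrow> (\<exists>t. valid_ctree n t \<and>
           real (ccost E inc dm t)
           \<le> 2 * real n powr (1 / log 2 ((real DIM('a) + 2) / (real DIM('a) + 1)))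
               * real M powr ((c / (2 - 2 * ((real DIM('a) + 1) / (real DIM('a) + 2))
                                            powr (1 - 1 / real DIM('a))))
                              * real k powr (1 / real DIM('a))
                              * real n powr (1 - 1 / real DIM('a))))"
proof -
  define d \<alpha> p C a q where "d = real DIM('a)" and "\<alpha> = (d + 1) / (d + 2)" and "p = 1 - 1 / d"
    and "C = c * real k powr (1 / d)" and "a = C / (2 - 2 * \<alpha> powr p)"
    and "q = 1 / log 2 ((d + 2) / (d + 1))"
  have d: "d \<ge> 2" using assms(1) by (simp add: d_def)
  have \<alpha>: "3 / 4 \<le> \<alpha>" "\<alpha> < 1" using d by (auto simp: \<alpha>_def field_simps)
  have p: "0 < p" "p < 1" using d by (auto simp: p_def field_simps)
  have C: "C \<ge> 0" using sphere_sep_const_nonneg[OF assms(4)] by (simp add: C_def)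
  \<comment> \<open>\<open>(d + 2) / (d + 1)\<close> lies strictly between 1 and 2. Counting the
    contractions uses one factor \<open>n\<close>, leaving \<open>n powr (q - 1)\<close> to
    spare.\<close>
  have q: "q > 1"
  proof -
    have "0 < log 2 ((d + 2) / (d + 1))" "log 2 ((d + 2) / (d + 1)) < 1"
      using d by (simp_all add: zero_less_log_cancel_iff log_less_one_cancel_iff divide_less_eq)
    then show ?thesis by (simp add: q_def)
  qed
  have lim: "((\<lambda>m. real m powr (p - 1)) \<longlongrightarrow> 0) sequentially"
    using p by (intro tendsto_neg_powr filterlim_real_sequentially) auto
  have "((\<lambda>m. C * real m powr (p - 1)) \<longlongrightarrow> C * 0) sequentially"
    by (intro tendsto_intros lim)
  then have ev1: "\<forall>\<^sub>F m in sequentially. C * real m powr (p - 1) < 1 - \<alpha>"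
    using \<alpha> by (intro order_tendstoD(2)[of _ "C * 0"]) auto
  have "((\<lambda>m. a * ln (real M) * (\<alpha> powr (p - 1) * real m powr (p - 1)))
      \<longlongrightarrow> a * ln (real M) * (\<alpha> powr (p - 1) * 0)) sequentially"
    by (intro tendsto_intros lim)
  then have ev2: "\<forall>\<^sub>F m in sequentially.
      a * ln (real M) * (\<alpha> powr (p - 1) * real m powr (p - 1)) < 1 / (2 * real M)"
    using assms(3) by (intro order_tendstoD(2)[of _ "a * ln (real M) * (\<alpha> powr (p - 1) * 0)"]) auto
  \<comment> \<open>The threshold is fixed before \<open>n\<close> and the network, so
    \<open>M powr m\<^sub>0\<close> is a constant.\<close>
  obtain m\<^sub>0 where m0: "\<And>m. m \<ge> m\<^sub>0 \<Longrightarrow> C * real m powr (p - 1) < 1 - \<alpha> \<and>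
      a * ln (real M) * (\<alpha> powr (p - 1) * real m powr (p - 1)) < 1 / (2 * real M)"
    using eventually_conj[OF ev1 ev2] unfolding eventually_sequentially by blast
  have small_sep: "C * real m powr p < (1 - \<alpha>) * real m" if "m > m\<^sub>0" for m
  proof -
    have m: "real m > 0" using that by simp
    have "C * real m powr p = C * real m powr (p - 1) * real m"
      using m by (simp add: powr_diff)
    also have "\<dots> < (1 - \<alpha>) * real m"
      using m0[OF less_imp_le[OF that]] m by (intro mult_strict_right_mono) auto
    finally show ?thesis .
  qed
  have small_slope: "a * ln (real M) * (\<alpha> * real m) powr (p - 1) \<le> 1 / (2 * real M)" if "m > m\<^sub>0" for m
    using m0[OF less_imp_le[OF that]] unfolding powr_mult by linarith
  \<comment> \<open>The spare power of \<open>n\<close> eventually exceeds the constant factor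
    \<open>M powr m\<^sub>0\<close>.\<close>
  have "((\<lambda>n. real n powr (- (q - 1))) \<longlongrightarrow> 0) sequentially"
    using q by (intro tendsto_neg_powr filterlim_real_sequentially) auto
  then have "\<forall>\<^sub>F n in sequentially. real n powr (- (q - 1)) < inverse (real M powr real m\<^sub>0)"
    using assms(3) by (intro order_tendstoD(2)[of _ 0]) auto
  then obtain N where *: "\<And>n. n \<ge> N \<Longrightarrow> inverse (real n powr (q - 1)) < inverse (real M powr real m\<^sub>0)"
    unfolding eventually_sequentially powr_minus by blast
  have N: "real M powr real m\<^sub>0 \<le> real n powr (q - 1)" if "n \<ge> N" "n \<ge> 1" for n
    by (rule less_imp_le, rule inverse_less_imp_less) (use * that in auto)
  show ?thesis
  \<comment> \<open>The maximum with 1 excludes the empty network, which has no contraction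
    tree.\<close>
  proof (intro exI[of _ "max N 1"] allI impI, elim conjE, goal_cases)
    case (1 n E inc dm ctr rad)
    then have n: "n \<ge> N" "n \<ge> 1" by auto
    note net = 1(2) and size = 1(3)[rule_format] and rad = 1(4)[rule_format]
      and meet = 1(5)[rule_format] and ply = 1(6)[rule_format]
    interpret sized_network n E inc dm M
      by unfold_locales (use net size assms(3) in auto)
    have "contractible {..<n}
        (wt (open_idx E inc {..<n}) + (a * real (card {..<n}) powr p + real m\<^sub>0) * ln (real M))"
    proof (rule contractible_by_separators[OF _ \<alpha> p(1) less_imp_le[OF p(2)] C a_def small_sep small_slope])
      fix S assume S: "S \<subseteq> {..<n}"
      obtain A B Q where un: "S = A \<union> B \<union> Q" and AB: "A \<inter> B = {}"
        and AQ: "A \<inter> Q = {}" "B \<inter> Q = {}"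
        and far: "\<And>i j. i \<in> A \<Longrightarrow> j \<in> B \<Longrightarrow> cball (ctr i) (rad i) \<inter> cball (ctr j) (rad j) = {}"
        and le: "card B \<le> card A" "real (card A) \<le> \<alpha> * real (card S)"
          "real (card Q) \<le> C * real (card S) powr p"
        by (rule sphere_separator_subset
            [OF assms(4,2) S rad ply, folded d_def, folded \<alpha>_def p_def C_def];
              (assumption | rule that))
      have "shared A B = {}"
      proof (rule ccontr)
        assume "shared A B \<noteq> {}"
        then obtain e i j where e: "e \<in> E" "i \<in> A" "j \<in> B" "e \<in> inc i" "e \<in> inc j"
          by (auto simp: shared_def)
        then have "i \<noteq> j" "i < n" "j < n" using un AB S by auto
        then show False using meet[OF e(1), of i j] far[OF e(2,3)] e(4,5) by simp
      qed
      with un AB AQ le show "\<exists>A B Q. S = A \<union> B \<union> Q \<and> A \<inter> B = {} \<and> A \<inter> Q = {} \<and> B \<inter> Q = {}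
          \<and> shared A B = {} \<and> card B \<le> card A \<and> real (card A) \<le> \<alpha> * real (card S)
          \<and> real (card Q) \<le> C * real (card S) powr p"
        by blast
    qed (use n in \<open>auto simp: lessThan_empty_iff\<close>)
    \<comment> \<open>Every index has both ends among the \<open>n\<close> tensors, so the boundary
      term vanishes.\<close>
    moreover have "open_idx E inc {..<n} = {}"
      using card_ends by (auto simp: open_idx_def)
    ultimately obtain t where t: "valid_ctree n t"
      and cost: "real (ccost E inc dm t)
        \<le> 2 * (real n - 1) * exp ((a * real n powr p + real m\<^sub>0) * ln (real M))"
      by (auto simp: contractible_def valid_ctree_def wt_def)
    note cost
    also have "2 * (real n - 1) * exp ((a * real n powr p + real m\<^sub>0) * ln (real M))
        = 2 * (real n - 1) * (real M powr real m\<^sub>0 * real M powr (a * real n powr p))"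
      using assms(3) by (simp add: powr_def exp_add algebra_simps)
    also have "\<dots> \<le> 2 * real n * (real n powr (q - 1) * real M powr (a * real n powr p))"
      using N[OF n] n by (intro mult_mono mult_right_mono) auto
    also have "\<dots> = 2 * real n powr q * real M powr (a * real n powr p)"
      using n by (simp add: powr_diff)
    also have "a = c / (2 - 2 * \<alpha> powr p) * real k powr (1 / d)"
      by (simp add: a_def C_def)
    finally show ?case
      using t unfolding q_def \<alpha>_def p_def d_def by blast
  qed
qed

end
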